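(* Let $\alpha\in(0,1)$ and $\beta=\frac1{1-\alpha}$. Consider the asymptotic model of an infinite $\alpha$-full hash table with random probing and Robin Hood collision resolution, in the steady state of an infinite alternating sequence of one random insertion followed by one random deletion (deletions implemented by marking cells as deleted, reusable by later insertions). Let $X$ be the search cost of a random key; its distribution is given by $\Pr\{X\ge i\}=s_i-s_{i+1}$ for $i\ge1$, where $s_1=\frac1{1-\alpha}$ and $s_{i+1}=\frac{\alpha s_i^2}{1+\alpha s_i}$. Then the variance of $X$ satisfies $$\sigma_\alpha^2\le\beta+\frac13=\frac1{1-\alpha}+\frac13.$$
   Context: Asymptotic model: table of $m$ slots with $n$ keys, $n,m\to\infty$, $n/m=\alpha$; each key has an infinite i.i.d. uniform probe sequence over the slots; a key at its $j$-th probe location has age (search cost) $j$. Robin Hood: each collision during an insertion is resolved in favor of the key with larger age. Here $s_i$ is the double tail $\sum_{j\ge i}\sum_{k\ge j}\Pr\{X=k\}$ of the steady-state distribution, which satisfies the stated recurrence in this model. *)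

theory Defs
  imports "HOL-Probability.Probability"
begin

end

theory Submission
  imports Defs
begin

text \<open>
  Put \<open>u n = s (n + 1)\<close>, so that \<open>Pr{X > n} = u n - u (n + 1) = u n / (1 + \<alpha> * u n)\<close>. Telescoping
  gives \<open>E X = u 0 = \<beta>\<close>, and \<open>E X\<^sup>2 = \<Sum>n. (2 * n + 1) * (u n - u (n + 1))\<close> is in essence
  \<open>2 * (\<Sum>n. u n) - \<beta>\<close>. The potential \<open>W x = \<alpha> * x\<^sup>2 / 2 + 3 * x / 2\<close> drops by at least \<open>u n\<close> from
  \<open>u n\<close> to \<open>u (n + 1)\<close>, hence \<open>\<Sum>n. u n \<le> W \<beta> = \<beta>\<^sup>2 / 2 + \<beta>\<close>, and the variance is at most \<open>\<beta>\<close>.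
\<close>

text \<open>Writing the inner sum as \<Sum>i. \<open>w i\<close> times the indicator of
  \<open>i < X\<close>, nonnegativity of the weights allows integrating term by term. Integrability
  thus comes out as a conclusion. Weights 1 give the mean; weights \<open>2 * i + 1\<close> give the
  second moment.\<close>

lemma (in prob_space) has_bochner_integral_sum_lessThan:
  fixes X :: "'a \<Rightarrow> nat" and w :: "nat \<Rightarrow> real"
  assumes X [measurable]: "X \<in> measurable M (count_space UNIV)"
    and w: "\<And>i. w i \<ge> 0"
    and sums: "(\<lambda>i. w i * measure M {\<omega> \<in> space M. i < X \<omega>}) sums S"
  shows "has_bochner_integral M (\<lambda>\<omega>. \<Sum>i<X \<omega>. w i) S"
proof (rule has_bochner_integral_nn_integral)
  have pointwise: "ennreal (\<Sum>i<X \<omega>. w i) = (\<Sum>i. ennreal (w i) * indicator {\<omega> \<in> space M. i < X \<omega>} \<omega>)"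
    if "\<omega> \<in> space M" for \<omega>
  proof -
    have "(\<Sum>i. ennreal (w i) * indicator {\<omega> \<in> space M. i < X \<omega>} \<omega>) =
        (\<Sum>i<X \<omega>. ennreal (w i) * indicator {\<omega> \<in> space M. i < X \<omega>} \<omega>)"
      by (rule suminf_finite) auto
    also have "\<dots> = (\<Sum>i<X \<omega>. ennreal (w i))"
      using that by (intro sum.cong) auto
    finally show ?thesis
      using w by (simp add: sum_ennreal)
  qed
  have "(\<integral>\<^sup>+ \<omega>. ennreal (\<Sum>i<X \<omega>. w i) \<partial>M) =
      (\<integral>\<^sup>+ \<omega>. (\<Sum>i. ennreal (w i) * indicator {\<omega> \<in> space M. i < X \<omega>} \<omega>) \<partial>M)"
    by (rule nn_integral_cong) (rule pointwise)
  also have "\<dots> = (\<Sum>i. ennreal (w i) * emeasure M {\<omega> \<in> space M. i < X \<omega>})"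
    by (simp add: nn_integral_suminf nn_integral_cmult_indicator)
  also have "\<dots> = (\<Sum>i. ennreal (w i * measure M {\<omega> \<in> space M. i < X \<omega>}))"
    using w by (simp add: emeasure_eq_measure ennreal_mult)
  also have "\<dots> = ennreal S"
    using w sums by (intro suminf_ennreal_eq) auto
  finally show "(\<integral>\<^sup>+ \<omega>. ennreal (\<Sum>i<X \<omega>. w i) \<partial>M) = ennreal S" .
  show "0 \<le> S"
    using w sums by (intro sums_le[OF _ sums_zero sums]) auto
qed (use w in \<open>auto intro: sum_nonneg\<close>)

lemma sum_odd_lessThan: "(\<Sum>i<n. 2 * real i + 1) = (real n)\<^sup>2"
  by (induction n) (auto simp: power2_eq_square algebra_simps)

text \<open>The right-hand side is \<open>x - x / (1 + a * x)\<close>, and the bound below uses \<open>a * (x / (1 + a * x)) \<le> 1\<close>.\<close>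

lemma potential_drop:
  fixes a x y :: real
  assumes "a > 0" "x \<ge> 0" and y: "y = a * x\<^sup>2 / (1 + a * x)"
  shows "a * y\<^sup>2 / 2 + 3 * y / 2 + x \<le> a * x\<^sup>2 / 2 + 3 * x / 2"
proof -
  define p where "p = x / (1 + a * x)"
  have pos: "1 + a * x > 0"
    using assms by (simp add: add_pos_nonneg)
  have x: "p * (1 + a * x) = x"
    using pos by (simp add: p_def)
  have "p \<ge> 0" "a * p \<le> 1"
    using assms pos by (auto simp: p_def divide_simps)
  have "y = a * x * p"
    by (simp add: y p_def power2_eq_square)
  then have y': "y = x - p"
    using x by (simp add: distrib_left mult_ac)
  \<comment> \<open>Here \<open>p\<close> is the drop \<open>x - y\<close>. The quadratic
    coefficient of the potential makes the terms \<open>2 * a * p * x\<close> cancel; the linear one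
    leaves a \<open>p\<close> that dominates \<open>a * p^2\<close>.\<close>
  have "a * x\<^sup>2 + 3 * x - (a * y\<^sup>2 + 3 * y) - 2 * (p * (1 + a * x)) = p * (1 - a * p)"
    unfolding y' by (simp add: power2_eq_square algebra_simps)
  moreover have "p * (1 - a * p) \<ge> 0"
    using \<open>p \<ge> 0\<close> \<open>a * p \<le> 1\<close> by simp
  ultimately show ?thesis
    using x by linarith
qed

theorem theorem3:
  fixes \<alpha> \<beta> :: real and s :: "nat \<Rightarrow> real"
    and M :: "'a measure" and X :: "'a \<Rightarrow> nat"
  assumes alpha: "0 < \<alpha>" "\<alpha> < 1"
    and beta: "\<beta> = 1 / (1 - \<alpha>)"
    and s_1: "s 1 = 1 / (1 - \<alpha>)"
    and s_Suc: "\<And>i. i \<ge> 1 \<Longrightarrow> s (i + 1) = \<alpha> * (s i)\<^sup>2 / (1 + \<alpha> * s i)"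
    and M: "prob_space M"
    and X: "X \<in> measurable M (count_space UNIV)"
    and X_distr: "\<And>i. i \<ge> 1 \<Longrightarrow> measure M {\<omega> \<in> space M. X \<omega> \<ge> i} = s i - s (i + 1)"
  shows "integrable M (\<lambda>\<omega>. (real (X \<omega>))\<^sup>2) \<and>
    prob_space.variance M (\<lambda>\<omega>. real (X \<omega>)) \<le> \<beta> + 1 / 3"
proof -
  interpret prob_space M by (rule M)
  define u where "u n = s (n + 1)" for n
  define W where "W x = \<alpha> * x\<^sup>2 / 2 + 3 * x / 2" for x
  have beta': "\<beta> > 0" "\<alpha> * \<beta> = \<beta> - 1"
    using alpha by (auto simp: beta field_simps)
  have u_0: "u 0 = \<beta>"
    using s_1 by (simp add: u_def beta)
  have u_Suc: "u (Suc n) = \<alpha> * (u n)\<^sup>2 / (1 + \<alpha> * u n)" for n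
    using s_Suc[of "n + 1"] by (simp add: u_def)
  have prob_eq: "measure M {\<omega> \<in> space M. n < X \<omega>} = u n - u (Suc n)" for n
    using X_distr[of "n + 1"] by (simp add: u_def Suc_le_eq)
  \<comment> \<open>\<beta> is the fixed point of \<open>1 + \<alpha> * x\<close>, so
    \<open>u n \<le> \<beta>\<close> amounts to \<open>u n \<le> 1 + \<alpha> * u n\<close>, which
    bounds the ratio of successive terms by \<alpha>.\<close>
  have decay: "u (Suc n) \<ge> 0 \<and> u (Suc n) \<le> \<alpha> * u n" if "0 \<le> u n" "u n \<le> \<beta>" for n
  proof -
    have "(1 - \<alpha>) * u n \<le> (1 - \<alpha>) * \<beta>"
      using that alpha by (intro mult_left_mono) auto
    then have "u n \<le> 1 + \<alpha> * u n"
      using alpha beta by (simp add: algebra_simps)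
    then have "(\<alpha> * u n) * u n \<le> (\<alpha> * u n) * (1 + \<alpha> * u n)"
      using that alpha by (intro mult_left_mono) auto
    moreover have "1 + \<alpha> * u n > 0"
      using that alpha by (simp add: add_pos_nonneg)
    ultimately show ?thesis
      using that alpha by (simp add: u_Suc pos_divide_le_eq power2_eq_square mult_ac)
  qed
  have u_bounds: "0 \<le> u n \<and> u n \<le> \<beta> * \<alpha> ^ n" for n
  proof (induction n)
    case 0
    then show ?case using beta' by (simp add: u_0)
  next
    case (Suc n)
    have "\<beta> * \<alpha> ^ n \<le> \<beta>"
      using alpha beta' by (simp add: power_le_one mult_left_le)
    then have "0 \<le> u (Suc n)" "u (Suc n) \<le> \<alpha> * u n"
      using decay[of n] Suc by auto
    moreover have "\<alpha> * u n \<le> \<alpha> * (\<beta> * \<alpha> ^ n)"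
      using Suc alpha by (intro mult_left_mono) auto
    ultimately show ?case
      by (simp add: mult_ac)
  qed
  have "u \<longlonglongrightarrow> 0"
  proof (rule tendsto_sandwich[where f = "\<lambda>_. 0"])
    show "(\<lambda>n. \<beta> * \<alpha> ^ n) \<longlonglongrightarrow> 0"
      using alpha by (intro tendsto_mult_right_zero LIMSEQ_power_zero) auto
  qed (use u_bounds in auto)
  then have "(\<lambda>n. 1 * measure M {\<omega> \<in> space M. n < X \<omega>}) sums \<beta>"
    using telescope_sums'[of u 0] by (simp add: prob_eq u_0)
  from has_bochner_integral_sum_lessThan[OF X _ this]
  have mean: "has_bochner_integral M (\<lambda>\<omega>. real (X \<omega>)) \<beta>"
    by simp

  define q where "q n = (2 * real n + 1) * measure M {\<omega> \<in> space M. n < X \<omega>}" for n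
  \<comment> \<open>By partial summation, \<open>(\<Sum>i<n. q i) + (2 * n - 1) * u n\<close> equals
    \<open>2 * (\<Sum>i<n. u i) - \<beta>\<close>, so each step adds \<open>2 * u n\<close>, which
    the drop of \<open>2 * W\<close> pays for. The right-hand side is the value at
    \<open>n = 0\<close>, namely \<open>2 * W \<beta> - \<beta>\<close>.\<close>
  have invariant: "(\<Sum>i<n. q i) + 2 * W (u n) + (2 * real n - 1) * u n \<le> \<beta>\<^sup>2 + \<beta>" for n
  proof (induction n)
    case 0
    have "\<alpha> * \<beta>\<^sup>2 = \<beta>\<^sup>2 - \<beta>"
      using arg_cong[OF beta'(2), of "\<lambda>t. t * \<beta>"] by (simp add: power2_eq_square left_diff_distrib mult.assoc)
    then show ?case
      by (simp add: W_def u_0 field_simps)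
  next
    case (Suc n)
    have "W (u (Suc n)) + u n \<le> W (u n)"
      unfolding W_def using alpha u_bounds u_Suc by (intro potential_drop) auto
    then show ?case
      using Suc by (simp add: q_def prob_eq algebra_simps)
  qed
  have q_partial: "(\<Sum>i<n. q i) \<le> \<beta>\<^sup>2 + \<beta>" for n
  proof -
    \<comment> \<open>The linear part \<open>3 * u n\<close> of \<open>2 * W (u n)\<close> absorbs
      the \<open>- u n\<close>, so no limit of \<open>n * u n\<close> has to be computed.\<close>
    have "2 * W (u n) + (2 * real n - 1) * u n = \<alpha> * (u n)\<^sup>2 + 2 * u n + 2 * real n * u n"
      by (simp add: W_def algebra_simps)
    also have "\<dots> \<ge> 0"
      using alpha u_bounds by (intro add_nonneg_nonneg mult_nonneg_nonneg) auto
    finally show ?thesis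
      using invariant[of n] by linarith
  qed
  \<comment> \<open>The uniform bound on partial sums yields both the finiteness of the second
    moment and its value bound \<open>\<beta>^2 + \<beta>\<close>; subtracting the squared mean
    leaves \<beta>.\<close>
  have "summable q"
    using q_partial by (intro summableI_nonneg_bounded) (auto simp: q_def)
  then have "q sums (suminf q)" and q_le: "suminf q \<le> \<beta>\<^sup>2 + \<beta>"
    using q_partial by (auto intro: suminf_le_const)
  then have "has_bochner_integral M (\<lambda>\<omega>. \<Sum>i<X \<omega>. 2 * real i + 1) (suminf q)"
    unfolding q_def by (intro has_bochner_integral_sum_lessThan X) auto
  then have square: "has_bochner_integral M (\<lambda>\<omega>. (real (X \<omega>))\<^sup>2) (suminf q)"
    by (simp add: sum_odd_lessThan)
  have "variance (\<lambda>\<omega>. real (X \<omega>)) = suminf q - \<beta>\<^sup>2"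
    using mean square variance_eq[of "\<lambda>\<omega>. real (X \<omega>)"] by (simp add: has_bochner_integral_iff)
  with q_le square show ?thesis
    by (simp add: has_bochner_integral_iff)
qed

end
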